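(* Let $l, m, n, r$ be nonnegative integers with $l \le m$ and $l \le r \le m+n$. Then $$\sum_{k=0}^{r} {k \brack l}\binom{m}{k}\binom{n}{r-k} = {m \brack l}\binom{m+n-l}{r-l},$$ where ${x \brack y}=\frac{x!}{(x-y)!}$ for nonnegative integers $x\ge y$, and the terms of the sum with $k<l$, $k>m$ or $r-k>n$ are taken to be $0$.
   Context: For nonnegative integers $x \ge y$, $\binom{x}{y}=\frac{x!}{(x-y)!\,y!}$ and ${x \brack y}=\frac{x!}{(x-y)!}$ (the falling factorial $x(x-1)\cdots(x-y+1)$, not a Stirling number); for nonnegative integers $y > x$, $\binom{x}{y}=0$ and ${x \brack y}=0$. *)

theory Defs
  imports Complex_Main
begin

text \<open>The falling factorial \<open>x! / (x - y)!\<close>, extended by \<open>0\<close> for \<open>y > x\<close>.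
  The guard is needed because \<open>x - y\<close> is truncated subtraction;
  \<open>falling_mult_fact\<close> below shows that the integer division is exact.\<close>

definition falling :: "nat \<Rightarrow> nat \<Rightarrow> nat" where
  "falling x y = (if y \<le> x then fact x div fact (x - y) else 0)"

lemma falling_mult_fact:
  assumes "y \<le> x"
  shows "falling x y * fact (x - y) = fact x"
proof -
  have "(fact (x - y) :: nat) dvd fact x"
    by (rule fact_dvd) simp
  then show ?thesis
    using assms by (simp add: falling_def)
qed

end

theory Submission
  imports Defs
begin

text \<open>The factor \<open>falling k l\<close> is absorbed into \<open>m choose k\<close>: by
  \<open>falling_mult_choose\<close> their product is the constant \<open>falling m l\<close> times
  \<open>(m - l) choose (k - l)\<close>. With the constant pulled out and the index shifted by
  \<open>l\<close>, the sum is Vandermonde's convolution for \<open>m - l\<close> and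
  \<open>n\<close>.\<close>

lemma falling_eq_fact_choose: "falling x y = fact y * (x choose y)"
proof (cases "y \<le> x")
  case True
  then have "falling x y * fact (x - y) = (fact y * (x choose y)) * fact (x - y)"
    using binomial_fact_lemma[OF True] by (simp add: falling_mult_fact mult_ac)
  then show ?thesis
    by simp
qed (simp add: falling_def)

text \<open>Up to the factor \<open>fact l\<close>, both sides count pairs of an
  \<open>l\<close>-set inside a \<open>k\<close>-set inside an \<open>m\<close>-set: choose the
  \<open>k\<close>-set first, or the \<open>l\<close>-set first.\<close>

lemma falling_mult_choose:
  assumes "l \<le> k" and "l \<le> m"
  shows "falling k l * (m choose k) = falling m l * ((m - l) choose (k - l))"
proof (cases "k \<le> m")
  case True
  then show ?thesis
    using choose_mult[OF assms(1) True] by (simp add: falling_eq_fact_choose mult_ac)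
\<comment> \<open>For \<open>k > m\<close> both binomials vanish, as \<open>l \<le> m\<close> gives
  \<open>m - l < k - l\<close> despite truncated subtraction.\<close>
qed (use assms in \<open>simp add: binomial_eq_0\<close>)

theorem theorem2p2:
  fixes l m n r :: nat
  assumes "l \<le> m" and "l \<le> r" and "r \<le> m + n"
  shows "(\<Sum>k=0..r. falling k l * (m choose k) * (n choose (r - k)))
           = falling m l * ((m + n - l) choose (r - l))"
proof -
  have "(\<Sum>k=0..r. falling k l * (m choose k) * (n choose (r - k)))
      = (\<Sum>k=l..r. falling k l * (m choose k) * (n choose (r - k)))"
    by (rule sum.mono_neutral_right) (auto simp: falling_def)
  also have "\<dots> = (\<Sum>k=l..r. falling m l * ((m - l) choose (k - l)) * (n choose (r - k)))"
    using assms(1) by (intro sum.cong) (simp_all add: falling_mult_choose)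
  \<comment> \<open>Put \<open>j = k - l\<close>; then \<open>r - k = r - l - j\<close>, and
    \<open>l \<le> r\<close> keeps \<open>j + l\<close> within the range.\<close>
  also have "\<dots> = (\<Sum>j\<le>r - l. falling m l * ((m - l) choose j) * (n choose (r - l - j)))"
    by (rule sum.reindex_bij_witness[of _ "\<lambda>j. j + l" "\<lambda>k. k - l"]) (use assms(2) in auto)
  also have "\<dots> = falling m l * ((m - l + n) choose (r - l))"
    by (simp add: vandermonde[symmetric] sum_distrib_left mult.assoc)
  finally show ?thesis
    using assms(1) by simp
qed

end
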